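(* Let $\mathcal{C}$ be a closed symmetric monoidal category and let $\mathcal{T}$ be a one-object category enriched over $\mathcal{C}$, with hom-object $T$, composition $\mu:T\otimes T\to T$ and unit $\iota:1_{\mathcal{C}}\to T$. Then the assignment $\Omega\mapsto\mathrm{shift}_\Omega$ is the object part of a functor $$\mathrm{shift}:\mathcal{C}\to[\text{Left-action}(\mathcal{C})],$$ whose action on a morphism $f:\Omega\to\Omega'$ is given by $[T;f]:[T;\Omega]\to[T;\Omega']$; in particular $$[T;f]\circ\mathrm{shift}_\Omega=\mathrm{shift}_{\Omega'}\circ(T\otimes[T;f]):\;T\otimes[T;\Omega]\to[T;\Omega'].$$
   Context: Time: the time semigroup $\mathcal{T}$ (with identity) is viewed as a one-object category enriched over $\mathcal{C}$; $(T,\mu,\iota)$ is then a monoid object in $\mathcal{C}$. Associators are suppressed. Internal homs: $[y;z]$ is the internal hom, with $\mathrm{Hom}(y\otimes x;z)\cong\mathrm{Hom}(x;[y;z])$ and evaluation $\mathrm{eval}:y\otimes[y;z]\to z$; $[T;f]$ is the functorial action of $[T;-]$ on $f$. Shift: $\mathrm{shift}_\Omega:T\otimes[T;\Omega]\to[T;\Omega]$ is the adjoint, with respect to the first (leftmost) factor $T$, of $T\otimes T\otimes[T;\Omega]\xrightarrow{\mu\otimes[T;\Omega]}T\otimes[T;\Omega]\xrightarrow{\mathrm{eval}}\Omega$. Left actions: $[\text{Left-action}(\mathcal{C})]$ is the category whose objects are pairs $(X,\Psi)$ with $\Psi:T\otimes X\to X$ such that $\Psi\circ(\iota\otimes X)$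 is the canonical isomorphism $1_{\mathcal{C}}\otimes X\cong X$ and $\Psi\circ(T\otimes\Psi)=\Psi\circ(\mu\otimes X)$; a morphism $(X,\Psi)\to(X',\Psi')$ is a morphism $h:X\to X'$ of $\mathcal{C}$ with $h\circ\Psi=\Psi'\circ(T\otimes h)$. *)

theory Defs
  imports Main
begin

record ('o, 'a) category =
  obj :: "'o set"
  arr :: "'a set"
  src :: "'a \<Rightarrow> 'o"
  tgt :: "'a \<Rightarrow> 'o"
  ide :: "'o \<Rightarrow> 'a"
  cmp :: "'a \<Rightarrow> 'a \<Rightarrow> 'a"  (infixr "\<cdot>\<index>" 65)

definition hom :: "('o, 'a, 'm) category_scheme \<Rightarrow> 'o \<Rightarrow> 'o \<Rightarrow> 'a set"
  where "hom C x y = {f \<in> arr C. src C f = x \<and> tgt C f = y}"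

locale category =
  fixes C :: "('o, 'a, 'm) category_scheme" (structure)
  assumes src_obj: "f \<in> arr C \<Longrightarrow> src C f \<in> obj C"
    and tgt_obj: "f \<in> arr C \<Longrightarrow> tgt C f \<in> obj C"
    and ide_hom: "x \<in> obj C \<Longrightarrow> ide C x \<in> hom C x x"
    and cmp_hom: "\<lbrakk>f \<in> hom C x y; g \<in> hom C y z\<rbrakk> \<Longrightarrow> g \<cdot> f \<in> hom C x z"
    and cmp_ide: "f \<in> hom C x y \<Longrightarrow> f \<cdot> ide C x = f"
    and ide_cmp: "f \<in> hom C x y \<Longrightarrow> ide C y \<cdot> f = f"
    and cmp_assoc: "\<lbrakk>f \<in> hom C w x; g \<in> hom C x y; h \<in> hom C y z\<rbrakk>
          \<Longrightarrow> (h \<cdot> g) \<cdot> f = h \<cdot> (g \<cdot> f)"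

locale category_functor = C: category C + D: category D
  for C :: "('o, 'a, 'm) category_scheme" and D :: "('p, 'b, 'n) category_scheme" +
  fixes Fo :: "'o \<Rightarrow> 'p" and Fa :: "'a \<Rightarrow> 'b"
  assumes obj_map: "x \<in> obj C \<Longrightarrow> Fo x \<in> obj D"
    and arr_map: "f \<in> hom C x y \<Longrightarrow> Fa f \<in> hom D (Fo x) (Fo y)"
    and ide_map: "x \<in> obj C \<Longrightarrow> Fa (ide C x) = ide D (Fo x)"
    and cmp_map: "\<lbrakk>f \<in> hom C x y; g \<in> hom C y z\<rbrakk>
          \<Longrightarrow> Fa (g \<cdot>\<^bsub>C\<^esub> f) = Fa g \<cdot>\<^bsub>D\<^esub> Fa f"

definition inverse_arrows :: "('o, 'a, 'm) category_scheme \<Rightarrow> 'a \<Rightarrow> 'a \<Rightarrow> bool"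
  where "inverse_arrows C f g \<longleftrightarrow>
    f \<in> arr C \<and> g \<in> hom C (tgt C f) (src C f) \<and>
    g \<cdot>\<^bsub>C\<^esub> f = ide C (src C f) \<and> f \<cdot>\<^bsub>C\<^esub> g = ide C (tgt C f)"

definition is_iso :: "('o, 'a, 'm) category_scheme \<Rightarrow> 'a \<Rightarrow> bool"
  where "is_iso C f \<longleftrightarrow> (\<exists>g. inverse_arrows C f g)"

definition inverse_of :: "('o, 'a, 'm) category_scheme \<Rightarrow> 'a \<Rightarrow> 'a"
  where "inverse_of C f = (THE g. inverse_arrows C f g)"

text \<open>
  Monoidal structure is not assumed strict; \<open>\<otimes>\<close> is the tensor product of objects and
  \<open>\<boxtimes>\<close> that of arrows, so that a product of an object \<open>x\<close> with an arrow \<open>f\<close> is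
  \<open>ide C x \<boxtimes> f\<close>. The associator goes from \<open>(x \<otimes> y) \<otimes> z\<close> to \<open>x \<otimes> (y \<otimes> z)\<close>.
\<close>

record ('o, 'a) monoidal_category = "('o, 'a) category" +
  tensor_obj :: "'o \<Rightarrow> 'o \<Rightarrow> 'o"  (infixr "\<otimes>\<index>" 75)
  tensor_arr :: "'a \<Rightarrow> 'a \<Rightarrow> 'a"  (infixr "\<boxtimes>\<index>" 75)
  unit_obj :: "'o"
  associator :: "'o \<Rightarrow> 'o \<Rightarrow> 'o \<Rightarrow> 'a"
  left_unitor :: "'o \<Rightarrow> 'a"
  right_unitor :: "'o \<Rightarrow> 'a"

locale monoidal_category = category C
  for C :: "('o, 'a, 'm) monoidal_category_scheme" (structure) +
  assumes tensor_obj: "\<lbrakk>x \<in> obj C; y \<in> obj C\<rbrakk> \<Longrightarrow> x \<otimes> y \<in> obj C"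
    and tensor_hom: "\<lbrakk>f \<in> hom C x x'; g \<in> hom C y y'\<rbrakk>
          \<Longrightarrow> f \<boxtimes> g \<in> hom C (x \<otimes> y) (x' \<otimes> y')"
    and tensor_ide: "\<lbrakk>x \<in> obj C; y \<in> obj C\<rbrakk>
          \<Longrightarrow> ide C x \<boxtimes> ide C y = ide C (x \<otimes> y)"
    and tensor_cmp: "\<lbrakk>f \<in> hom C x x'; f' \<in> hom C x' x''; g \<in> hom C y y'; g' \<in> hom C y' y''\<rbrakk>
          \<Longrightarrow> (f' \<cdot> f) \<boxtimes> (g' \<cdot> g) = (f' \<boxtimes> g') \<cdot> (f \<boxtimes> g)"
    and unit_obj: "unit_obj C \<in> obj C"
    and associator_hom: "\<lbrakk>x \<in> obj C; y \<in> obj C; z \<in> obj C\<rbrakk>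
          \<Longrightarrow> associator C x y z \<in> hom C ((x \<otimes> y) \<otimes> z) (x \<otimes> (y \<otimes> z))"
    and associator_iso: "\<lbrakk>x \<in> obj C; y \<in> obj C; z \<in> obj C\<rbrakk>
          \<Longrightarrow> is_iso C (associator C x y z)"
    and associator_natural: "\<lbrakk>f \<in> hom C x x'; g \<in> hom C y y'; h \<in> hom C z z'\<rbrakk>
          \<Longrightarrow> associator C x' y' z' \<cdot> ((f \<boxtimes> g) \<boxtimes> h)
            = (f \<boxtimes> (g \<boxtimes> h)) \<cdot> associator C x y z"
    and left_unitor_hom: "x \<in> obj C \<Longrightarrow> left_unitor C x \<in> hom C (unit_obj C \<otimes> x) x"
    and left_unitor_iso: "x \<in> obj C \<Longrightarrow> is_iso C (left_unitor C x)"
    and left_unitor_natural: "f \<in> hom C x y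
          \<Longrightarrow> left_unitor C y \<cdot> (ide C (unit_obj C) \<boxtimes> f) = f \<cdot> left_unitor C x"
    and right_unitor_hom: "x \<in> obj C \<Longrightarrow> right_unitor C x \<in> hom C (x \<otimes> unit_obj C) x"
    and right_unitor_iso: "x \<in> obj C \<Longrightarrow> is_iso C (right_unitor C x)"
    and right_unitor_natural: "f \<in> hom C x y
          \<Longrightarrow> right_unitor C y \<cdot> (f \<boxtimes> ide C (unit_obj C)) = f \<cdot> right_unitor C x"
    and pentagon: "\<lbrakk>w \<in> obj C; x \<in> obj C; y \<in> obj C; z \<in> obj C\<rbrakk>
          \<Longrightarrow> associator C w x (y \<otimes> z) \<cdot> associator C (w \<otimes> x) y z
            = (ide C w \<boxtimes> associator C x y z) \<cdot> associator C w (x \<otimes> y) z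
                \<cdot> (associator C w x y \<boxtimes> ide C z)"
    and triangle: "\<lbrakk>x \<in> obj C; y \<in> obj C\<rbrakk>
          \<Longrightarrow> (ide C x \<boxtimes> left_unitor C y) \<cdot> associator C x (unit_obj C) y
            = right_unitor C x \<boxtimes> ide C y"

record ('o, 'a) symmetric_monoidal_category = "('o, 'a) monoidal_category" +
  symmetry :: "'o \<Rightarrow> 'o \<Rightarrow> 'a"

locale symmetric_monoidal_category = monoidal_category C
  for C :: "('o, 'a, 'm) symmetric_monoidal_category_scheme" (structure) +
  assumes symmetry_hom: "\<lbrakk>x \<in> obj C; y \<in> obj C\<rbrakk>
          \<Longrightarrow> symmetry C x y \<in> hom C (x \<otimes> y) (y \<otimes> x)"
    and symmetry_natural: "\<lbrakk>f \<in> hom C x x'; g \<in> hom C y y'\<rbrakk>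
          \<Longrightarrow> symmetry C x' y' \<cdot> (f \<boxtimes> g) = (g \<boxtimes> f) \<cdot> symmetry C x y"
    and symmetry_symmetry: "\<lbrakk>x \<in> obj C; y \<in> obj C\<rbrakk>
          \<Longrightarrow> symmetry C y x \<cdot> symmetry C x y = ide C (x \<otimes> y)"
    and hexagon: "\<lbrakk>x \<in> obj C; y \<in> obj C; z \<in> obj C\<rbrakk>
          \<Longrightarrow> associator C y z x \<cdot> symmetry C x (y \<otimes> z) \<cdot> associator C x y z
            = (ide C y \<boxtimes> symmetry C x z) \<cdot> associator C y x z
                \<cdot> (symmetry C x y \<boxtimes> ide C z)"

text \<open>
  \<open>internal_hom C y z\<close> is \<open>[y; z]\<close>, and \<open>curry_arr C y x z\<close> is the adjunction bijection
  \<open>Hom(y \<otimes> x; z) \<cong> Hom(x; [y; z])\<close>, natural in \<open>x\<close>. Its naturality in \<open>z\<close> needs no axiom: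
  the action of \<open>[y; -]\<close> on arrows (\<open>internal_hom_map\<close> below) is induced by the bijection.
\<close>

record ('o, 'a) closed_symmetric_monoidal_category = "('o, 'a) symmetric_monoidal_category" +
  internal_hom :: "'o \<Rightarrow> 'o \<Rightarrow> 'o"
  curry_arr :: "'o \<Rightarrow> 'o \<Rightarrow> 'o \<Rightarrow> 'a \<Rightarrow> 'a"

locale closed_symmetric_monoidal_category = symmetric_monoidal_category C
  for C :: "('o, 'a, 'm) closed_symmetric_monoidal_category_scheme" (structure) +
  assumes internal_hom_obj: "\<lbrakk>y \<in> obj C; z \<in> obj C\<rbrakk> \<Longrightarrow> internal_hom C y z \<in> obj C"
    and curry_bij: "\<lbrakk>x \<in> obj C; y \<in> obj C; z \<in> obj C\<rbrakk>
          \<Longrightarrow> bij_betw (curry_arr C y x z) (hom C (y \<otimes> x) z) (hom C x (internal_hom C y z))"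
    and curry_natural: "\<lbrakk>h \<in> hom C x' x; y \<in> obj C; f \<in> hom C (y \<otimes> x) z\<rbrakk>
          \<Longrightarrow> curry_arr C y x' z (f \<cdot> (ide C y \<boxtimes> h)) = curry_arr C y x z f \<cdot> h"

definition eval_arr ::
    "('o, 'a, 'm) closed_symmetric_monoidal_category_scheme \<Rightarrow> 'o \<Rightarrow> 'o \<Rightarrow> 'a"
  where "eval_arr C y z =
    inv_into (hom C (y \<otimes>\<^bsub>C\<^esub> internal_hom C y z) z) (curry_arr C y (internal_hom C y z) z)
      (ide C (internal_hom C y z))"

definition internal_hom_map ::
    "('o, 'a, 'm) closed_symmetric_monoidal_category_scheme \<Rightarrow> 'o \<Rightarrow> 'a \<Rightarrow> 'a"
  where "internal_hom_map C y f =
    curry_arr C y (internal_hom C y (src C f)) (tgt C f) (f \<cdot>\<^bsub>C\<^esub> eval_arr C y (src C f))"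

record ('i, 'o, 'a) enriched_category =
  enr_obj :: "'i set"
  enr_hom :: "'i \<Rightarrow> 'i \<Rightarrow> 'o"
  enr_cmp :: "'i \<Rightarrow> 'i \<Rightarrow> 'i \<Rightarrow> 'a"
  enr_ide :: "'i \<Rightarrow> 'a"

locale enriched_category = monoidal_category C
  for C :: "('o, 'a, 'm) monoidal_category_scheme" (structure)
    and E :: "('i, 'o, 'a, 'n) enriched_category_scheme" +
  assumes enr_hom_obj: "\<lbrakk>p \<in> enr_obj E; q \<in> enr_obj E\<rbrakk> \<Longrightarrow> enr_hom E p q \<in> obj C"
    and enr_cmp_hom: "\<lbrakk>p \<in> enr_obj E; q \<in> enr_obj E; r \<in> enr_obj E\<rbrakk>
          \<Longrightarrow> enr_cmp E p q r \<in> hom C (enr_hom E q r \<otimes> enr_hom E p q) (enr_hom E p r)"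
    and enr_ide_hom: "p \<in> enr_obj E \<Longrightarrow> enr_ide E p \<in> hom C (unit_obj C) (enr_hom E p p)"
    and enr_cmp_assoc: "\<lbrakk>p \<in> enr_obj E; q \<in> enr_obj E; r \<in> enr_obj E; s \<in> enr_obj E\<rbrakk>
          \<Longrightarrow> enr_cmp E p q s \<cdot> (enr_cmp E q r s \<boxtimes> ide C (enr_hom E p q))
            = enr_cmp E p r s \<cdot> (ide C (enr_hom E r s) \<boxtimes> enr_cmp E p q r)
                \<cdot> associator C (enr_hom E r s) (enr_hom E q r) (enr_hom E p q)"
    and enr_ide_cmp: "\<lbrakk>p \<in> enr_obj E; q \<in> enr_obj E\<rbrakk>
          \<Longrightarrow> enr_cmp E p q q \<cdot> (enr_ide E q \<boxtimes> ide C (enr_hom E p q))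
            = left_unitor C (enr_hom E p q)"
    and enr_cmp_ide: "\<lbrakk>p \<in> enr_obj E; q \<in> enr_obj E\<rbrakk>
          \<Longrightarrow> enr_cmp E p p q \<cdot> (ide C (enr_hom E p q) \<boxtimes> enr_ide E p)
            = right_unitor C (enr_hom E p q)"

definition left_action ::
    "('o, 'a, 'm) monoidal_category_scheme \<Rightarrow> 'o \<Rightarrow> 'a \<Rightarrow> 'a \<Rightarrow> 'o \<Rightarrow> 'a \<Rightarrow> bool"
  where "left_action C T \<mu> \<iota> X \<Psi> \<longleftrightarrow>
    X \<in> obj C \<and> \<Psi> \<in> hom C (T \<otimes>\<^bsub>C\<^esub> X) X \<and>
    \<Psi> \<cdot>\<^bsub>C\<^esub> (\<iota> \<boxtimes>\<^bsub>C\<^esub> ide C X) = left_unitor C X \<and>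
    \<Psi> \<cdot>\<^bsub>C\<^esub> (ide C T \<boxtimes>\<^bsub>C\<^esub> \<Psi>) \<cdot>\<^bsub>C\<^esub> associator C T T X = \<Psi> \<cdot>\<^bsub>C\<^esub> (\<mu> \<boxtimes>\<^bsub>C\<^esub> ide C X)"

definition equivariant ::
    "('o, 'a, 'm) monoidal_category_scheme \<Rightarrow> 'o \<Rightarrow> 'o \<times> 'a \<Rightarrow> 'o \<times> 'a \<Rightarrow> 'a \<Rightarrow> bool"
  where "equivariant C T A B h \<longleftrightarrow>
    h \<in> hom C (fst A) (fst B) \<and> h \<cdot>\<^bsub>C\<^esub> snd A = snd B \<cdot>\<^bsub>C\<^esub> (ide C T \<boxtimes>\<^bsub>C\<^esub> h)"

text \<open>An arrow \<open>A \<rightarrow> B\<close> is stored with its source and target, as a triple \<open>(A, h, B)\<close>.\<close>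

definition left_action_category ::
    "('o, 'a, 'm) monoidal_category_scheme \<Rightarrow> 'o \<Rightarrow> 'a \<Rightarrow> 'a
      \<Rightarrow> ('o \<times> 'a, ('o \<times> 'a) \<times> 'a \<times> ('o \<times> 'a)) category"
  where "left_action_category C T \<mu> \<iota> =
    \<lparr> obj = {(X, \<Psi>). left_action C T \<mu> \<iota> X \<Psi>},
      arr = {((X, \<Psi>), h, (X', \<Psi>')) | X \<Psi> h X' \<Psi>'.
               left_action C T \<mu> \<iota> X \<Psi> \<and> left_action C T \<mu> \<iota> X' \<Psi>' \<and>
               equivariant C T (X, \<Psi>) (X', \<Psi>') h},
      src = (\<lambda>(A, h, B). A),
      tgt = (\<lambda>(A, h, B). B),
      ide = (\<lambda>(X, \<Psi>). ((X, \<Psi>), ide C X, (X, \<Psi>))),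
      cmp = (\<lambda>(B, g, D) (A, f, B'). (A, g \<cdot>\<^bsub>C\<^esub> f, D)) \<rparr>"

text \<open>
  The transpose, with respect to the leftmost \<open>T\<close>, of
  \<open>T \<otimes> (T \<otimes> [T; \<Omega>]) \<cong> (T \<otimes> T) \<otimes> [T; \<Omega>] \<rightarrow> T \<otimes> [T; \<Omega>] \<rightarrow> \<Omega>\<close>.
\<close>

definition shift ::
    "('o, 'a, 'm) closed_symmetric_monoidal_category_scheme \<Rightarrow> 'o \<Rightarrow> 'a \<Rightarrow> 'o \<Rightarrow> 'a"
  where "shift C T \<mu> \<Omega> =
    curry_arr C T (T \<otimes>\<^bsub>C\<^esub> internal_hom C T \<Omega>) \<Omega>
      (eval_arr C T \<Omega> \<cdot>\<^bsub>C\<^esub> (\<mu> \<boxtimes>\<^bsub>C\<^esub> ide C (internal_hom C T \<Omega>))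
        \<cdot>\<^bsub>C\<^esub> inverse_of C (associator C T T (internal_hom C T \<Omega>)))"

definition shift_obj ::
    "('o, 'a, 'm) closed_symmetric_monoidal_category_scheme \<Rightarrow> 'o \<Rightarrow> 'a \<Rightarrow> 'o \<Rightarrow> 'o \<times> 'a"
  where "shift_obj C T \<mu> \<Omega> = (internal_hom C T \<Omega>, shift C T \<mu> \<Omega>)"

definition shift_arr ::
    "('o, 'a, 'm) closed_symmetric_monoidal_category_scheme \<Rightarrow> 'o \<Rightarrow> 'a \<Rightarrow> 'a
      \<Rightarrow> ('o \<times> 'a) \<times> 'a \<times> ('o \<times> 'a)"
  where "shift_arr C T \<mu> f =
    (shift_obj C T \<mu> (src C f), internal_hom_map C T f, shift_obj C T \<mu> (tgt C f))"

end

theory Submission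
  imports Defs
begin

text \<open>
  Write \<open>H = [T; \<Omega>]\<close>, \<open>e = eval\<close> and \<open>s = shift\<close>. By the adjunction, an arrow \<open>h\<close> into \<open>H\<close> is
  determined by its transpose \<open>e \<cdot> (T \<boxtimes> h)\<close> (\<open>transpose_inject\<close>), and \<open>s\<close> is the arrow with
  \<open>e \<cdot> (T \<boxtimes> s) \<cdot> a = e \<cdot> (\<mu> \<boxtimes> H)\<close>, where \<open>a\<close> is the associator (\<open>shift_transpose\<close>). So each
  equation between arrows into \<open>H\<close> is checked on transposes, and this rule together with naturality
  of \<open>a\<close> turns occurrences of \<open>s\<close> into occurrences of \<open>\<mu>\<close>:

  \<^item> the unit law of the action becomes \<open>e\<close> after the right unit law of \<open>T\<close>, tensored with \<open>H\<close>; the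
    two unitors are matched by the triangle identity (\<open>shift_unit\<close>);
  \<^item> the multiplication law becomes \<open>e\<close> after the associativity of \<open>\<mu>\<close>, tensored with \<open>H\<close>; the
    bracketings are matched by the pentagon identity (\<open>shift_mult\<close>);
  \<^item> equivariance of \<open>[T; f]\<close>, whose transpose is \<open>f \<cdot> e\<close>, becomes the interchange of \<open>\<mu>\<close> with
    \<open>[T; f]\<close> (\<open>shift_natural\<close>).

  In elements, \<open>(s(t, \<phi>))(r) = \<phi>(r t)\<close>: shifting by \<open>t\<close> multiplies the argument by \<open>t\<close> on the
  right, and \<open>(r t) t' = r (t t')\<close> makes this a left action.

  No strictness is assumed, so the associators are carried along. The functor lands in a category
  because identities are equivariant and equivariant arrows compose
  (\<open>left_action_category_is_category\<close>), and \<open>[T; -]\<close> respects identities and composition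
  (\<open>internal_hom_map_ide\<close>, \<open>internal_hom_map_cmp\<close>).
\<close>

section \<open>Composition and tensor in terms of source and target\<close>

lemma hom_iff: "f \<in> hom C x y \<longleftrightarrow> f \<in> arr C \<and> src C f = x \<and> tgt C f = y"
  by (auto simp: hom_def)

text \<open>
  The category laws restated without hom-sets: each side condition compares a source with a target
  or states membership in \<open>arr C\<close> or \<open>obj C\<close>, so no objects have to be guessed and rewriting
  discharges it.
\<close>

context category
begin

lemma arr_ide:
  assumes "x \<in> obj C"
  shows "ide C x \<in> arr C" "src C (ide C x) = x" "tgt C (ide C x) = x"
  using ide_hom[OF assms] by (auto simp: hom_iff)

lemma arr_cmp:
  assumes "f \<in> arr C" "g \<in> arr C" "tgt C f = src C g"
  shows "g \<cdot> f \<in> arr C" "src C (g \<cdot> f) = src C f" "tgt C (g \<cdot> f) = tgt C g"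
  using cmp_hom[of f "src C f" "src C g" g "tgt C g"] assms by (auto simp: hom_iff)

lemma cmp_ide_arr: "\<lbrakk>f \<in> arr C; src C f = x\<rbrakk> \<Longrightarrow> f \<cdot> ide C x = f"
  using cmp_ide by (auto simp: hom_iff)

lemma ide_cmp_arr: "\<lbrakk>f \<in> arr C; tgt C f = x\<rbrakk> \<Longrightarrow> ide C x \<cdot> f = f"
  using ide_cmp by (auto simp: hom_iff)

lemma cmp_assoc_arr:
  assumes "f \<in> arr C" "g \<in> arr C" "h \<in> arr C" "tgt C f = src C g" "tgt C g = src C h"
  shows "(h \<cdot> g) \<cdot> f = h \<cdot> (g \<cdot> f)"
  using cmp_assoc[of f "src C f" "src C g" g "src C h" h "tgt C h"] assms by (auto simp: hom_iff)

lemmas arr_simps = hom_iff src_obj tgt_obj arr_ide arr_cmp cmp_ide_arr ide_cmp_arr cmp_assoc_arr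

lemma inverse_arrows_unique:
  assumes "inverse_arrows C f g" "inverse_arrows C f g'"
  shows "g = g'"
proof -
  have "g = g \<cdot> (f \<cdot> g')"
    using assms by (auto simp: inverse_arrows_def arr_simps)
  also have "\<dots> = (g \<cdot> f) \<cdot> g'"
    using assms by (intro cmp_assoc_arr[symmetric]) (auto simp: inverse_arrows_def hom_iff)
  also have "\<dots> = g'"
    using assms by (auto simp: inverse_arrows_def arr_simps)
  finally show ?thesis .
qed

lemma inverse_of_iso: "is_iso C f \<Longrightarrow> inverse_arrows C f (inverse_of C f)"
  unfolding is_iso_def inverse_of_def by (metis inverse_arrows_unique theI)

lemma iso_epi:
  assumes iso: "is_iso C f"
    and g: "g \<in> hom C (tgt C f) z" and h: "h \<in> hom C (tgt C f) z"
    and eq: "g \<cdot> f = h \<cdot> f"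
  shows "g = h"
proof -
  obtain k where k: "f \<in> arr C" "k \<in> arr C" "src C k = tgt C f" "tgt C k = src C f"
      "f \<cdot> k = ide C (tgt C f)"
    using iso by (auto simp: is_iso_def inverse_arrows_def hom_iff)
  have "g = (g \<cdot> f) \<cdot> k" using g k by (simp add: arr_simps)
  also have "\<dots> = (h \<cdot> f) \<cdot> k" by (simp only: eq)
  also have "\<dots> = h" using h k by (simp add: arr_simps)
  finally show ?thesis .
qed

end

context monoidal_category
begin

lemma arr_tensor:
  assumes "f \<in> arr C" "g \<in> arr C"
  shows "f \<boxtimes> g \<in> arr C" "src C (f \<boxtimes> g) = src C f \<otimes> src C g" "tgt C (f \<boxtimes> g) = tgt C f \<otimes> tgt C g"
  using tensor_hom[of f "src C f" "tgt C f" g "src C g" "tgt C g"] assms by (auto simp: hom_iff)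

lemma arr_associator:
  assumes "x \<in> obj C" "y \<in> obj C" "z \<in> obj C"
  shows "associator C x y z \<in> arr C" "src C (associator C x y z) = (x \<otimes> y) \<otimes> z"
    "tgt C (associator C x y z) = x \<otimes> (y \<otimes> z)"
  using associator_hom[OF assms] by (auto simp: hom_iff)

lemma arr_left_unitor:
  assumes "x \<in> obj C"
  shows "left_unitor C x \<in> arr C" "src C (left_unitor C x) = unit_obj C \<otimes> x"
    "tgt C (left_unitor C x) = x"
  using left_unitor_hom[OF assms] by (auto simp: hom_iff)

lemmas monoidal_arr_simps = arr_simps tensor_obj unit_obj arr_tensor arr_associator arr_left_unitor

lemma tensor_cmp_arr:
  assumes "f \<in> arr C" "f' \<in> arr C" "g \<in> arr C" "g' \<in> arr C" "tgt C f = src C f'" "tgt C g = src C g'"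
  shows "(f' \<boxtimes> g') \<cdot> (f \<boxtimes> g) = (f' \<cdot> f) \<boxtimes> (g' \<cdot> g)"
  using tensor_cmp[of f "src C f" "src C f'" f' "tgt C f'" g "src C g" "src C g'" g' "tgt C g'"] assms
  by (auto simp: hom_iff)

lemma left_whisker_cmp:
  assumes "x \<in> obj C" "f \<in> arr C" "g \<in> arr C" "tgt C f = src C g"
  shows "ide C x \<boxtimes> (g \<cdot> f) = (ide C x \<boxtimes> g) \<cdot> (ide C x \<boxtimes> f)"
  using assms by (simp add: tensor_cmp_arr monoidal_arr_simps)

lemma interchange:
  assumes "f \<in> hom C x x'" "g \<in> hom C y y'"
  shows "(f \<boxtimes> ide C y') \<cdot> (ide C x \<boxtimes> g) = (ide C x' \<boxtimes> g) \<cdot> (f \<boxtimes> ide C y)"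
  using assms by (auto simp: tensor_cmp_arr monoidal_arr_simps)

lemma iso_tensor_ide:
  assumes "is_iso C f" "x \<in> obj C"
  shows "is_iso C (f \<boxtimes> ide C x)"
proof -
  obtain g where "inverse_arrows C f g" using assms(1) by (auto simp: is_iso_def)
  then have "inverse_arrows C (f \<boxtimes> ide C x) (g \<boxtimes> ide C x)"
    using assms(2) by (auto simp: inverse_arrows_def tensor_cmp_arr monoidal_arr_simps tensor_ide)
  then show ?thesis by (auto simp: is_iso_def)
qed

section \<open>The category of left actions\<close>

lemma left_action_category_hom:
  "u \<in> hom (left_action_category C T \<mu> \<iota>) A B \<longleftrightarrow>
    left_action C T \<mu> \<iota> (fst A) (snd A) \<and> left_action C T \<mu> \<iota> (fst B) (snd B) \<and>
    equivariant C T A B (fst (snd u)) \<and> u = (A, fst (snd u), B)"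
  by (cases u; cases A; cases B) (auto simp: hom_iff left_action_category_def)

lemma left_action_category_cmp:
  "(B, g, D) \<cdot>\<^bsub>left_action_category C T \<mu> \<iota>\<^esub> (A, f, B') = (A, g \<cdot> f, D)"
  by (simp add: left_action_category_def)

lemma equivariant_ide:
  assumes "T \<in> obj C" "left_action C T \<mu> \<iota> X \<Psi>"
  shows "equivariant C T (X, \<Psi>) (X, \<Psi>) (ide C X)"
  using assms by (auto simp: equivariant_def left_action_def monoidal_arr_simps tensor_ide)

lemma equivariant_cmp:
  assumes T: "T \<in> obj C"
    and f: "equivariant C T (X, \<Phi>) (Y, \<Psi>) f" and g: "equivariant C T (Y, \<Psi>) (Z, \<Theta>) g"
    and X: "\<Phi> \<in> hom C (T \<otimes> X) X" and Y: "\<Psi> \<in> hom C (T \<otimes> Y) Y" and Z: "\<Theta> \<in> hom C (T \<otimes> Z) Z"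
  shows "equivariant C T (X, \<Phi>) (Z, \<Theta>) (g \<cdot> f)"
proof -
  have fg: "f \<in> hom C X Y" "g \<in> hom C Y Z"
    and f_eq: "f \<cdot> \<Phi> = \<Psi> \<cdot> (ide C T \<boxtimes> f)" and g_eq: "g \<cdot> \<Psi> = \<Theta> \<cdot> (ide C T \<boxtimes> g)"
    using f g by (auto simp: equivariant_def)
  have "(g \<cdot> f) \<cdot> \<Phi> = g \<cdot> (f \<cdot> \<Phi>)" using fg X by (simp add: arr_simps)
  also have "\<dots> = (g \<cdot> \<Psi>) \<cdot> (ide C T \<boxtimes> f)"
    using T fg Y by (auto simp: f_eq monoidal_arr_simps)
  also have "\<dots> = \<Theta> \<cdot> (ide C T \<boxtimes> (g \<cdot> f))"
    using T fg Z by (auto simp: g_eq monoidal_arr_simps left_whisker_cmp)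
  finally show ?thesis
    using fg by (auto simp: equivariant_def arr_simps)
qed

lemma left_action_category_is_category:
  assumes T: "T \<in> obj C"
  shows "category (left_action_category C T \<mu> \<iota>)" (is "category ?L")
proof
  fix u assume "u \<in> arr ?L"
  then show "src ?L u \<in> obj ?L" and "tgt ?L u \<in> obj ?L"
    by (auto simp: left_action_category_def)
next
  fix A assume "A \<in> obj ?L"
  then show "ide ?L A \<in> hom ?L A A"
    using equivariant_ide[OF T] by (auto simp: left_action_category_hom)
      (auto simp: left_action_category_def)
next
  fix u v A B D assume "u \<in> hom ?L A B" "v \<in> hom ?L B D"
  then show "v \<cdot>\<^bsub>?L\<^esub> u \<in> hom ?L A D"
    using equivariant_cmp[OF T, of "fst A" "snd A" "fst B" "snd B" "fst (snd u)" "fst D" "snd D"]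
    by (cases u; cases v) (auto simp: left_action_category_hom left_action_category_cmp left_action_def)
next
  fix u A B assume "u \<in> hom ?L A B"
  then show "u \<cdot>\<^bsub>?L\<^esub> ide ?L A = u" "ide ?L B \<cdot>\<^bsub>?L\<^esub> u = u"
    by (cases u; cases A; cases B;
        auto simp: left_action_category_hom left_action_category_def equivariant_def arr_simps)+
next
  fix u v w A B D F assume "u \<in> hom ?L A B" "v \<in> hom ?L B D" "w \<in> hom ?L D F"
  then show "(w \<cdot>\<^bsub>?L\<^esub> v) \<cdot>\<^bsub>?L\<^esub> u = w \<cdot>\<^bsub>?L\<^esub> (v \<cdot>\<^bsub>?L\<^esub> u)"
    by (cases u; cases v; cases w)
       (auto simp: left_action_category_hom left_action_category_def equivariant_def arr_simps)
qed

end

section \<open>Transposes\<close>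

context closed_symmetric_monoidal_category
begin

lemma curry_hom:
  assumes "x \<in> obj C" "y \<in> obj C" "f \<in> hom C (y \<otimes> x) z"
  shows "curry_arr C y x z f \<in> hom C x (internal_hom C y z)"
proof -
  have "z \<in> obj C" using assms(3) tgt_obj by (auto simp: hom_iff)
  then show ?thesis using curry_bij assms by (blast intro: bij_betwE[THEN bspec])
qed

lemma
  assumes "y \<in> obj C" "z \<in> obj C"
  shows eval_hom: "eval_arr C y z \<in> hom C (y \<otimes> internal_hom C y z) z"
    and curry_eval: "curry_arr C y (internal_hom C y z) z (eval_arr C y z) = ide C (internal_hom C y z)"
proof -
  let ?H = "internal_hom C y z"
  have H: "?H \<in> obj C" using assms internal_hom_obj by simp
  have "ide C ?H \<in> curry_arr C y ?H z ` hom C (y \<otimes> ?H) z"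
    using curry_bij[OF H assms] ide_hom[OF H] by (simp add: bij_betw_def)
  then show "eval_arr C y z \<in> hom C (y \<otimes> ?H) z" "curry_arr C y ?H z (eval_arr C y z) = ide C ?H"
    unfolding eval_arr_def by (auto intro: inv_into_into f_inv_into_f)
qed

lemma arr_internal_hom:
  assumes "y \<in> obj C" "z \<in> obj C"
  shows "internal_hom C y z \<in> obj C" "eval_arr C y z \<in> arr C"
    "src C (eval_arr C y z) = y \<otimes> internal_hom C y z" "tgt C (eval_arr C y z) = z"
  using internal_hom_obj[OF assms] eval_hom[OF assms] by (auto simp: hom_iff)

lemmas closed_arr_simps = monoidal_arr_simps arr_internal_hom

lemma curry_transpose:
  assumes "y \<in> obj C" "z \<in> obj C" "h \<in> hom C x (internal_hom C y z)"
  shows "curry_arr C y x z (eval_arr C y z \<cdot> (ide C y \<boxtimes> h)) = h"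
  using curry_natural[OF assms(3,1) eval_hom[OF assms(1,2)]] curry_eval[OF assms(1,2)] assms(3)
  by (simp add: ide_cmp)

lemma transpose_inject:
  assumes "y \<in> obj C" "z \<in> obj C" "h \<in> hom C x (internal_hom C y z)" "k \<in> hom C x (internal_hom C y z)"
    and "eval_arr C y z \<cdot> (ide C y \<boxtimes> h) = eval_arr C y z \<cdot> (ide C y \<boxtimes> k)"
  shows "h = k"
  using assms curry_transpose by metis

lemma transpose_curry:
  assumes x: "x \<in> obj C" and y: "y \<in> obj C" and f: "f \<in> hom C (y \<otimes> x) z"
  shows "eval_arr C y z \<cdot> (ide C y \<boxtimes> curry_arr C y x z f) = f"
proof -
  have z: "z \<in> obj C" using f tgt_obj by (auto simp: hom_iff)
  let ?h = "curry_arr C y x z f"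
  have h: "?h \<in> hom C x (internal_hom C y z)" by (rule curry_hom[OF x y f])
  then have g: "eval_arr C y z \<cdot> (ide C y \<boxtimes> ?h) \<in> hom C (y \<otimes> x) z"
    using y z by (auto simp: closed_arr_simps)
  have "inj_on (curry_arr C y x z) (hom C (y \<otimes> x) z)"
    using curry_bij[OF x y z] by (simp add: bij_betw_def)
  then show ?thesis using curry_transpose[OF y z h] f g by (auto dest: inj_onD)
qed

text \<open>
  For arrows out of a tensor product, equality of transposes may be tested after reassociating
  the source.
\<close>

lemma transpose_inject_assoc:
  assumes y: "y \<in> obj C" and z: "z \<in> obj C" and u: "u \<in> obj C" and v: "v \<in> obj C"
    and h: "h \<in> hom C (u \<otimes> v) (internal_hom C y z)" and k: "k \<in> hom C (u \<otimes> v) (internal_hom C y z)"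
    and eq: "eval_arr C y z \<cdot> (ide C y \<boxtimes> h) \<cdot> associator C y u v
      = eval_arr C y z \<cdot> (ide C y \<boxtimes> k) \<cdot> associator C y u v"
  shows "h = k"
proof (rule transpose_inject[OF y z h k], rule iso_epi)
  show "is_iso C (associator C y u v)" using associator_iso y u v by simp
  show "(eval_arr C y z \<cdot> (ide C y \<boxtimes> h)) \<cdot> associator C y u v
      = (eval_arr C y z \<cdot> (ide C y \<boxtimes> k)) \<cdot> associator C y u v"
    using eq y z u v h k by (simp add: closed_arr_simps)
qed (use y z u v h k in \<open>auto simp: closed_arr_simps\<close>)

lemma internal_hom_map_hom:
  assumes "y \<in> obj C" "f \<in> hom C z z'"
  shows "internal_hom_map C y f \<in> hom C (internal_hom C y z) (internal_hom C y z')"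
proof -
  have "z \<in> obj C" "z' \<in> obj C" using assms src_obj tgt_obj by (auto simp: hom_iff)
  then show ?thesis
    using assms curry_hom[of "internal_hom C y z" y "f \<cdot> eval_arr C y z" z']
    by (auto simp: internal_hom_map_def closed_arr_simps)
qed

lemma transpose_internal_hom_map:
  assumes "y \<in> obj C" "f \<in> hom C z z'"
  shows "eval_arr C y z' \<cdot> (ide C y \<boxtimes> internal_hom_map C y f) = f \<cdot> eval_arr C y z"
proof -
  have "z \<in> obj C" "z' \<in> obj C" using assms src_obj tgt_obj by (auto simp: hom_iff)
  then show ?thesis
    using assms transpose_curry[of "internal_hom C y z" y "f \<cdot> eval_arr C y z" z']
    by (auto simp: internal_hom_map_def closed_arr_simps)
qed

lemma internal_hom_map_ide:
  assumes "y \<in> obj C" "z \<in> obj C"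
  shows "internal_hom_map C y (ide C z) = ide C (internal_hom C y z)"
  using assms curry_eval by (simp add: internal_hom_map_def closed_arr_simps)

lemma internal_hom_map_cmp:
  assumes y: "y \<in> obj C" and f: "f \<in> hom C x z" and g: "g \<in> hom C z w"
  shows "internal_hom_map C y (g \<cdot> f) = internal_hom_map C y g \<cdot> internal_hom_map C y f"
proof -
  have objs: "x \<in> obj C" "z \<in> obj C" "w \<in> obj C" using f g src_obj tgt_obj by (auto simp: hom_iff)
  have gf: "g \<cdot> f \<in> hom C x w" using f g by (rule cmp_hom)
  let ?F = "internal_hom_map C y f" and ?G = "internal_hom_map C y g"
  note F = internal_hom_map_hom[OF y f] and G = internal_hom_map_hom[OF y g]
  have "eval_arr C y w \<cdot> (ide C y \<boxtimes> (?G \<cdot> ?F))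
      = (eval_arr C y w \<cdot> (ide C y \<boxtimes> ?G)) \<cdot> (ide C y \<boxtimes> ?F)"
    using y objs F G by (simp add: closed_arr_simps left_whisker_cmp)
  also have "\<dots> = g \<cdot> (eval_arr C y z \<cdot> (ide C y \<boxtimes> ?F))"
    using y objs F g by (simp add: transpose_internal_hom_map[OF y g] closed_arr_simps)
  also have "\<dots> = (g \<cdot> f) \<cdot> eval_arr C y x"
    using y objs f g by (simp add: transpose_internal_hom_map[OF y f] closed_arr_simps)
  finally show ?thesis
    using transpose_inject[OF y objs(3) internal_hom_map_hom[OF y gf] cmp_hom[OF F G]]
      transpose_internal_hom_map[OF y gf] by simp
qed

section \<open>The shift action\<close>

context
  fixes T \<mu>
  assumes T: "T \<in> obj C" and mu: "\<mu> \<in> hom C (T \<otimes> T) T"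
begin

lemma
  assumes Om: "\<Omega> \<in> obj C"
  shows shift_hom: "shift C T \<mu> \<Omega> \<in> hom C (T \<otimes> internal_hom C T \<Omega>) (internal_hom C T \<Omega>)"
    and shift_transpose:
      "eval_arr C T \<Omega> \<cdot> (ide C T \<boxtimes> shift C T \<mu> \<Omega>) \<cdot> associator C T T (internal_hom C T \<Omega>)
        = eval_arr C T \<Omega> \<cdot> (\<mu> \<boxtimes> ide C (internal_hom C T \<Omega>))"
proof -
  let ?H = "internal_hom C T \<Omega>" and ?e = "eval_arr C T \<Omega>"
  let ?a = "associator C T T ?H"
  let ?b = "inverse_of C ?a"
  let ?g = "?e \<cdot> (\<mu> \<boxtimes> ide C ?H) \<cdot> ?b"
  have H: "?H \<in> obj C" using T Om by (rule internal_hom_obj)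
  have "inverse_arrows C ?a ?b"
    using inverse_of_iso associator_iso T H by simp
  then have b: "?b \<in> arr C" "src C ?b = T \<otimes> (T \<otimes> ?H)" "tgt C ?b = (T \<otimes> T) \<otimes> ?H"
      "?b \<cdot> ?a = ide C ((T \<otimes> T) \<otimes> ?H)"
    using T H by (auto simp: inverse_arrows_def closed_arr_simps)
  have g: "?g \<in> hom C (T \<otimes> (T \<otimes> ?H)) \<Omega>"
    using b T Om H mu by (simp add: closed_arr_simps)
  show s: "shift C T \<mu> \<Omega> \<in> hom C (T \<otimes> ?H) ?H"
    unfolding shift_def using T H g by (intro curry_hom tensor_obj)
  have "?e \<cdot> (ide C T \<boxtimes> shift C T \<mu> \<Omega>) = ?g"
    unfolding shift_def using T H g by (intro transpose_curry tensor_obj)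
  then have "(?e \<cdot> (ide C T \<boxtimes> shift C T \<mu> \<Omega>)) \<cdot> ?a = ?e \<cdot> (\<mu> \<boxtimes> ide C ?H) \<cdot> (?b \<cdot> ?a)"
    using b(1-3) T Om H mu by (simp add: closed_arr_simps)
  then show "?e \<cdot> (ide C T \<boxtimes> shift C T \<mu> \<Omega>) \<cdot> ?a = ?e \<cdot> (\<mu> \<boxtimes> ide C ?H)"
    using b s T Om H mu by (simp add: closed_arr_simps)
qed

text \<open>
  For generalized elements \<open>f\<close> and \<open>g\<close> of \<open>T\<close>, shifting by \<open>g\<close> and then evaluating at \<open>f\<close> is
  evaluating at the product \<open>\<mu> \<cdot> (f \<boxtimes> g)\<close>.
\<close>

lemma shift_transpose_natural:
  assumes Om: "\<Omega> \<in> obj C" and f: "f \<in> hom C x T" and g: "g \<in> hom C y T"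
  shows "eval_arr C T \<Omega> \<cdot> (ide C T \<boxtimes> shift C T \<mu> \<Omega>) \<cdot> (f \<boxtimes> (g \<boxtimes> ide C (internal_hom C T \<Omega>)))
        \<cdot> associator C x y (internal_hom C T \<Omega>)
      = eval_arr C T \<Omega> \<cdot> ((\<mu> \<cdot> (f \<boxtimes> g)) \<boxtimes> ide C (internal_hom C T \<Omega>))"
proof -
  let ?H = "internal_hom C T \<Omega>" and ?e = "eval_arr C T \<Omega>" and ?s = "shift C T \<mu> \<Omega>"
  have H: "?H \<in> obj C" using T Om by (rule internal_hom_obj)
  have objs: "x \<in> obj C" "y \<in> obj C" using f g src_obj by (auto simp: hom_iff)
  note types = T mu Om H f g objs shift_hom[OF Om]
  have "?e \<cdot> (ide C T \<boxtimes> ?s) \<cdot> (f \<boxtimes> (g \<boxtimes> ide C ?H)) \<cdot> associator C x y ?H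
      = ?e \<cdot> (ide C T \<boxtimes> ?s) \<cdot> associator C T T ?H \<cdot> ((f \<boxtimes> g) \<boxtimes> ide C ?H)"
    by (simp only: associator_natural[OF f g ide_hom[OF H]])
  also have "\<dots> = (?e \<cdot> (ide C T \<boxtimes> ?s) \<cdot> associator C T T ?H) \<cdot> ((f \<boxtimes> g) \<boxtimes> ide C ?H)"
    using types by (simp add: closed_arr_simps)
  also have "\<dots> = ?e \<cdot> (\<mu> \<boxtimes> ide C ?H) \<cdot> ((f \<boxtimes> g) \<boxtimes> ide C ?H)"
    using types by (simp only: shift_transpose[OF Om]) (simp add: closed_arr_simps)
  also have "\<dots> = ?e \<cdot> ((\<mu> \<cdot> (f \<boxtimes> g)) \<boxtimes> ide C ?H)"
    using types by (simp add: closed_arr_simps tensor_cmp_arr)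
  finally show ?thesis .
qed

lemma shift_unit:
  assumes Om: "\<Omega> \<in> obj C" and iota: "\<iota> \<in> hom C (unit_obj C) T"
    and unit: "\<mu> \<cdot> (ide C T \<boxtimes> \<iota>) = right_unitor C T"
  shows "shift C T \<mu> \<Omega> \<cdot> (\<iota> \<boxtimes> ide C (internal_hom C T \<Omega>)) = left_unitor C (internal_hom C T \<Omega>)"
proof -
  let ?H = "internal_hom C T \<Omega>" and ?e = "eval_arr C T \<Omega>" and ?s = "shift C T \<mu> \<Omega>"
  let ?a = "associator C T (unit_obj C) ?H"
  have H: "?H \<in> obj C" using T Om by (rule internal_hom_obj)
  note types = T mu Om H iota shift_hom[OF Om]
  have "?e \<cdot> (ide C T \<boxtimes> (?s \<cdot> (\<iota> \<boxtimes> ide C ?H))) \<cdot> ?a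
      = ?e \<cdot> (ide C T \<boxtimes> ?s) \<cdot> (ide C T \<boxtimes> (\<iota> \<boxtimes> ide C ?H)) \<cdot> ?a"
    using types by (simp add: closed_arr_simps left_whisker_cmp)
  also have "\<dots> = ?e \<cdot> (right_unitor C T \<boxtimes> ide C ?H)"
    by (simp only: shift_transpose_natural[OF Om ide_hom[OF T] iota] unit)
  also have "\<dots> = ?e \<cdot> (ide C T \<boxtimes> left_unitor C ?H) \<cdot> ?a"
    by (simp only: triangle[OF T H])
  finally show ?thesis
    by (rule transpose_inject_assoc[OF T Om unit_obj H, rotated 2])
      (use types in \<open>simp_all add: closed_arr_simps\<close>)
qed

lemma shift_mult:
  assumes Om: "\<Omega> \<in> obj C"
    and assoc: "\<mu> \<cdot> (\<mu> \<boxtimes> ide C T) = \<mu> \<cdot> (ide C T \<boxtimes> \<mu>) \<cdot> associator C T T T"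
  shows "shift C T \<mu> \<Omega> \<cdot> (ide C T \<boxtimes> shift C T \<mu> \<Omega>) \<cdot> associator C T T (internal_hom C T \<Omega>)
    = shift C T \<mu> \<Omega> \<cdot> (\<mu> \<boxtimes> ide C (internal_hom C T \<Omega>))"
proof -
  let ?H = "internal_hom C T \<Omega>" and ?e = "eval_arr C T \<Omega>" and ?s = "shift C T \<mu> \<Omega>"
  let ?a = "associator C T T ?H" and ?b = "associator C T (T \<otimes> T) ?H"
  let ?c = "associator C T T T \<boxtimes> ide C ?H" and ?d = "associator C (T \<otimes> T) T ?H"
  let ?L = "?s \<cdot> (ide C T \<boxtimes> ?s) \<cdot> ?a" and ?R = "?s \<cdot> (\<mu> \<boxtimes> ide C ?H)"
  have H: "?H \<in> obj C" using T Om by (rule internal_hom_obj)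
  have TT: "T \<otimes> T \<in> obj C" and TH: "T \<otimes> ?H \<in> obj C" using T H by (auto intro: tensor_obj)
  note s = shift_hom[OF Om]
  note types = T mu Om H TT TH s
  \<comment> \<open>Besides \<open>?b\<close>, the isomorphism \<open>?c\<close> is composed on the right: the three associators
    then form the longer side of the pentagon.\<close>
  have "(?e \<cdot> (ide C T \<boxtimes> ?L) \<cdot> ?b) \<cdot> ?c
      = ?e \<cdot> (ide C T \<boxtimes> ?s) \<cdot> (ide C T \<boxtimes> (ide C T \<boxtimes> ?s)) \<cdot> ((ide C T \<boxtimes> ?a) \<cdot> ?b \<cdot> ?c)"
    using types by (simp add: closed_arr_simps left_whisker_cmp)
  also have "\<dots> = ?e \<cdot> (ide C T \<boxtimes> ?s) \<cdot> (ide C T \<boxtimes> (ide C T \<boxtimes> ?s)) \<cdot> (associator C T T (T \<otimes> ?H) \<cdot> ?d)"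
    by (simp only: pentagon[OF T T T H])
  also have "\<dots> = ?e \<cdot> (ide C T \<boxtimes> ?s)
      \<cdot> ((ide C T \<boxtimes> (ide C T \<boxtimes> ?s)) \<cdot> associator C T T (T \<otimes> ?H)) \<cdot> ?d"
    using types by (simp add: closed_arr_simps)
  also have "\<dots> = ?e \<cdot> (ide C T \<boxtimes> ?s) \<cdot> (?a \<cdot> (ide C (T \<otimes> T) \<boxtimes> ?s)) \<cdot> ?d"
    by (simp only: associator_natural[OF ide_hom[OF T] ide_hom[OF T] s, symmetric] tensor_ide[OF T T])
  also have "\<dots> = (?e \<cdot> (ide C T \<boxtimes> ?s) \<cdot> ?a) \<cdot> (ide C (T \<otimes> T) \<boxtimes> ?s) \<cdot> ?d"
    using types by (simp add: closed_arr_simps)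
  also have "\<dots> = ?e \<cdot> ((\<mu> \<boxtimes> ide C ?H) \<cdot> (ide C (T \<otimes> T) \<boxtimes> ?s)) \<cdot> ?d"
    using types by (simp only: shift_transpose[OF Om]) (simp add: closed_arr_simps)
  also have "\<dots> = ?e \<cdot> ((ide C T \<boxtimes> ?s) \<cdot> (\<mu> \<boxtimes> (ide C T \<boxtimes> ide C ?H))) \<cdot> ?d"
    by (simp only: interchange[OF mu s] tensor_ide[OF T H])
  also have "\<dots> = ?e \<cdot> (ide C T \<boxtimes> ?s) \<cdot> (\<mu> \<boxtimes> (ide C T \<boxtimes> ide C ?H)) \<cdot> ?d"
    using types by (simp add: closed_arr_simps)
  also have "\<dots> = ?e \<cdot> ((\<mu> \<cdot> (\<mu> \<boxtimes> ide C T)) \<boxtimes> ide C ?H)"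
    by (rule shift_transpose_natural[OF Om mu ide_hom[OF T]])
  also have "\<dots> = (?e \<cdot> ((\<mu> \<cdot> (ide C T \<boxtimes> \<mu>)) \<boxtimes> ide C ?H)) \<cdot> ?c"
    unfolding assoc using types by (simp add: closed_arr_simps tensor_cmp_arr)
  also have "\<dots> = (?e \<cdot> (ide C T \<boxtimes> ?s) \<cdot> (ide C T \<boxtimes> (\<mu> \<boxtimes> ide C ?H)) \<cdot> ?b) \<cdot> ?c"
    by (simp only: shift_transpose_natural[OF Om ide_hom[OF T] mu])
  also have "\<dots> = (?e \<cdot> (ide C T \<boxtimes> ?R) \<cdot> ?b) \<cdot> ?c"
    using types by (simp add: closed_arr_simps left_whisker_cmp)
  finally have "?e \<cdot> (ide C T \<boxtimes> ?L) \<cdot> ?b = ?e \<cdot> (ide C T \<boxtimes> ?R) \<cdot> ?b"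
    by (rule iso_epi[OF iso_tensor_ide[OF associator_iso[OF T T T] H], rotated 2])
      (use types in \<open>simp_all add: closed_arr_simps\<close>)
  then show ?thesis
    by (rule transpose_inject_assoc[OF T Om TT H, rotated 2])
      (use types in \<open>simp_all add: closed_arr_simps\<close>)
qed

lemma shift_natural:
  assumes f: "f \<in> hom C \<Omega> \<Omega>'"
  shows "internal_hom_map C T f \<cdot> shift C T \<mu> \<Omega> = shift C T \<mu> \<Omega>' \<cdot> (ide C T \<boxtimes> internal_hom_map C T f)"
proof -
  let ?H = "internal_hom C T \<Omega>" and ?e = "eval_arr C T \<Omega>" and ?s = "shift C T \<mu> \<Omega>"
  let ?H' = "internal_hom C T \<Omega>'" and ?e' = "eval_arr C T \<Omega>'" and ?s' = "shift C T \<mu> \<Omega>'"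
  let ?a = "associator C T T ?H" and ?a' = "associator C T T ?H'"
  let ?F = "internal_hom_map C T f"
  have Om: "\<Omega> \<in> obj C" "\<Omega>' \<in> obj C" using f src_obj tgt_obj by (auto simp: hom_iff)
  have H: "?H \<in> obj C" "?H' \<in> obj C" using T Om internal_hom_obj by auto
  note F = internal_hom_map_hom[OF T f] and F_transpose = transpose_internal_hom_map[OF T f]
  note types = T mu f Om H F shift_hom[OF Om(1)] shift_hom[OF Om(2)]
  have "?e' \<cdot> (ide C T \<boxtimes> (?F \<cdot> ?s)) \<cdot> ?a = (?e' \<cdot> (ide C T \<boxtimes> ?F)) \<cdot> (ide C T \<boxtimes> ?s) \<cdot> ?a"
    using types by (simp add: closed_arr_simps left_whisker_cmp)
  also have "\<dots> = f \<cdot> (?e \<cdot> (ide C T \<boxtimes> ?s) \<cdot> ?a)"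
    using types by (simp only: F_transpose) (simp add: closed_arr_simps)
  also have "\<dots> = (f \<cdot> ?e) \<cdot> (\<mu> \<boxtimes> ide C ?H)"
    using types by (simp only: shift_transpose[OF Om(1)]) (simp add: closed_arr_simps)
  also have "\<dots> = ?e' \<cdot> ((ide C T \<boxtimes> ?F) \<cdot> (\<mu> \<boxtimes> ide C ?H))"
    using types by (simp only: F_transpose[symmetric]) (simp add: closed_arr_simps)
  also have "\<dots> = ?e' \<cdot> ((\<mu> \<boxtimes> ide C ?H') \<cdot> (ide C (T \<otimes> T) \<boxtimes> ?F))"
    by (simp only: interchange[OF mu F])
  also have "\<dots> = (?e' \<cdot> (\<mu> \<boxtimes> ide C ?H')) \<cdot> (ide C (T \<otimes> T) \<boxtimes> ?F)"
    using types by (simp add: closed_arr_simps)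
  also have "\<dots> = ?e' \<cdot> (ide C T \<boxtimes> ?s') \<cdot> (?a' \<cdot> ((ide C T \<boxtimes> ide C T) \<boxtimes> ?F))"
    using types by (simp only: shift_transpose[OF Om(2), symmetric] tensor_ide[OF T T])
      (simp add: closed_arr_simps)
  also have "\<dots> = ?e' \<cdot> (ide C T \<boxtimes> ?s') \<cdot> ((ide C T \<boxtimes> (ide C T \<boxtimes> ?F)) \<cdot> ?a)"
    by (simp only: associator_natural[OF ide_hom[OF T] ide_hom[OF T] F])
  also have "\<dots> = ?e' \<cdot> (ide C T \<boxtimes> (?s' \<cdot> (ide C T \<boxtimes> ?F))) \<cdot> ?a"
    using types by (simp add: closed_arr_simps left_whisker_cmp)
  finally show ?thesis
    by (rule transpose_inject_assoc[OF T Om(2) T H(1), rotated 2])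
      (use types in \<open>simp_all add: closed_arr_simps\<close>)
qed

end

text \<open>
  The unit law of the action comes from the right unit law of \<open>T\<close>, since the shift of \<open>\<phi>\<close> by
  the unit takes \<open>r\<close> to the value of \<open>\<phi>\<close> at \<open>r \<iota>\<close>.
\<close>

lemma shift_functor:
  assumes T: "T \<in> obj C" and mu: "\<mu> \<in> hom C (T \<otimes> T) T" and iota: "\<iota> \<in> hom C (unit_obj C) T"
    and assoc: "\<mu> \<cdot> (\<mu> \<boxtimes> ide C T) = \<mu> \<cdot> (ide C T \<boxtimes> \<mu>) \<cdot> associator C T T T"
    and unit: "\<mu> \<cdot> (ide C T \<boxtimes> \<iota>) = right_unitor C T"
  shows "category_functor C (left_action_category C T \<mu> \<iota>) (shift_obj C T \<mu>) (shift_arr C T \<mu>)"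
    (is "category_functor C ?L _ _")
proof -
  interpret L: category ?L by (rule left_action_category_is_category[OF T])
  have action: "left_action C T \<mu> \<iota> (internal_hom C T \<Omega>) (shift C T \<mu> \<Omega>)" if "\<Omega> \<in> obj C" for \<Omega>
    unfolding left_action_def
    using that internal_hom_obj[OF T] shift_hom[OF T mu] shift_unit[OF T mu _ iota unit]
      shift_mult[OF T mu _ assoc] by simp
  show ?thesis
  proof
    fix x assume "x \<in> obj C"
    then show "shift_obj C T \<mu> x \<in> obj ?L"
      using action by (simp add: shift_obj_def left_action_category_def)
  next
    fix f x y assume f: "f \<in> hom C x y"
    then have xy: "src C f = x" "tgt C f = y" "x \<in> obj C" "y \<in> obj C"
      using src_obj tgt_obj by (auto simp: hom_iff)
    then show "shift_arr C T \<mu> f \<in> hom ?L (shift_obj C T \<mu> x) (shift_obj C T \<mu> y)"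
      using action internal_hom_map_hom[OF T f] shift_natural[OF T mu f]
      by (simp add: left_action_category_hom shift_arr_def shift_obj_def equivariant_def)
  next
    fix x assume "x \<in> obj C"
    then show "shift_arr C T \<mu> (ide C x) = ide ?L (shift_obj C T \<mu> x)"
      using T by (simp add: shift_arr_def shift_obj_def left_action_category_def
          internal_hom_map_ide arr_ide)
  next
    fix f g x y z assume f: "f \<in> hom C x y" and g: "g \<in> hom C y z"
    then show "shift_arr C T \<mu> (g \<cdot> f) = shift_arr C T \<mu> g \<cdot>\<^bsub>?L\<^esub> shift_arr C T \<mu> f"
      using internal_hom_map_cmp[OF T f g]
      by (simp add: shift_arr_def left_action_category_def arr_simps)
  qed
qed

end

theorem theorem3:
  fixes C :: "('o, 'a, 'm) closed_symmetric_monoidal_category_scheme" (structure)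
    and E :: "('i, 'o, 'a, 'n) enriched_category_scheme"
    and p :: 'i and T :: 'o and \<mu> \<iota> :: 'a
  assumes "closed_symmetric_monoidal_category C"
    and "enriched_category C E"
    and "enr_obj E = {p}"
    and "T = enr_hom E p p"
    and "\<mu> = enr_cmp E p p p"
    and "\<iota> = enr_ide E p"
  shows "category_functor C (left_action_category C T \<mu> \<iota>) (shift_obj C T \<mu>) (shift_arr C T \<mu>)
    \<and> (\<forall>\<Omega> \<Omega>' f. f \<in> hom C \<Omega> \<Omega>' \<longrightarrow>
          internal_hom_map C T f \<in> hom C (internal_hom C T \<Omega>) (internal_hom C T \<Omega>') \<and>
          internal_hom_map C T f \<cdot> shift C T \<mu> \<Omega>
            \<in> hom C (T \<otimes> internal_hom C T \<Omega>) (internal_hom C T \<Omega>') \<and>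
          internal_hom_map C T f \<cdot> shift C T \<mu> \<Omega>
            = shift C T \<mu> \<Omega>' \<cdot> (ide C T \<boxtimes> internal_hom_map C T f))"
proof -
  interpret closed_symmetric_monoidal_category C by fact
  interpret E: enriched_category C E by fact
  have p: "p \<in> enr_obj E" using assms(3) by simp
  have T: "T \<in> obj C" using E.enr_hom_obj[OF p p] assms by simp
  have mu: "\<mu> \<in> hom C (T \<otimes> T) T" using E.enr_cmp_hom[OF p p p] assms by simp
  have iota: "\<iota> \<in> hom C (unit_obj C) T" using E.enr_ide_hom[OF p] assms by simp
  have assoc: "\<mu> \<cdot> (\<mu> \<boxtimes> ide C T) = \<mu> \<cdot> (ide C T \<boxtimes> \<mu>) \<cdot> associator C T T T"
    using E.enr_cmp_assoc[OF p p p p] assms by simp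
  have unit: "\<mu> \<cdot> (ide C T \<boxtimes> \<iota>) = right_unitor C T"
    using E.enr_cmp_ide[OF p p] assms by simp
  show ?thesis
  proof (intro conjI allI impI)
    show "category_functor C (left_action_category C T \<mu> \<iota>) (shift_obj C T \<mu>) (shift_arr C T \<mu>)"
      by (rule shift_functor[OF T mu iota assoc unit])
  next
    fix \<Omega> \<Omega>' f assume f: "f \<in> hom C \<Omega> \<Omega>'"
    then have Om: "\<Omega> \<in> obj C" using src_obj by (auto simp: hom_iff)
    show F: "internal_hom_map C T f \<in> hom C (internal_hom C T \<Omega>) (internal_hom C T \<Omega>')"
      by (rule internal_hom_map_hom[OF T f])
    show "internal_hom_map C T f \<cdot> shift C T \<mu> \<Omega>
        \<in> hom C (T \<otimes> internal_hom C T \<Omega>) (internal_hom C T \<Omega>')"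
      by (rule cmp_hom[OF shift_hom[OF T mu Om] F])
    show "internal_hom_map C T f \<cdot> shift C T \<mu> \<Omega>
        = shift C T \<mu> \<Omega>' \<cdot> (ide C T \<boxtimes> internal_hom_map C T f)"
      by (rule shift_natural[OF T mu f])
  qed
qed

end
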